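(* Let $P$ be a level Eulerian poset whose underlying matrix $M$ is indecomposable. Then the order of the matrix $M$ (its number of rows) is even.
   Context: Level poset of a binary matrix: let $M$ be a $0/1$ square matrix with rows and columns indexed by a finite nonempty set $V$. The level poset of $M$ is the poset on $V\times\mathbb{Z}$ with $(u,i)<(v,j)$ if and only if $i<j$ and $(M^{j-i})_{u,v}>0$; the projection onto the second coordinate is its rank function, and $M$ is called its underlying matrix. A finite graded poset (with minimum, maximum and rank function $\rho$) is Eulerian if every interval $[x,y]$ in it of rank at least $1$ satisfies $\sum_{x\le z\le y}(-1)^{\rho(z)}=0$. A level poset is level Eulerian if every one of its intervals is Eulerian. A nonnegative square matrix $M$ is indecomposable if for all indices $i,j$ there is $t>0$ with $(M^t)_{i,j}>0$. *)

theory Defs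
  imports "HOL-Analysis.Analysis"
begin

section \<open>Finite graded and Eulerian posets\<close>

text \<open>
  A poset is given by its carrier \<open>A\<close> and its reflexive order relation \<open>r\<close>,
  subject to \<^const>\<open>partial_order_on\<close>.
\<close>

definition poset_interval :: "'a rel \<Rightarrow> 'a \<Rightarrow> 'a \<Rightarrow> 'a set" where
  "poset_interval r x y = {z. (x, z) \<in> r \<and> (z, y) \<in> r}"

definition covered_by :: "'a rel \<Rightarrow> 'a \<Rightarrow> 'a \<Rightarrow> bool" where
  "covered_by r x y \<longleftrightarrow> (x, y) \<in> r \<and> x \<noteq> y \<and> poset_interval r x y = {x, y}"

text \<open>
  Rank functions are integer-valued and are not normalized to vanish at the minimum, so that a
  rank function restricts to every interval. The rank of \<open>[x, y]\<close> is \<open>\<rho> y - \<rho> x\<close>.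
\<close>

definition rank_function :: "'a rel \<Rightarrow> ('a \<Rightarrow> int) \<Rightarrow> bool" where
  "rank_function r \<rho> \<longleftrightarrow>
     (\<forall>x y. (x, y) \<in> r \<and> x \<noteq> y \<longrightarrow> \<rho> x < \<rho> y) \<and>
     (\<forall>x y. covered_by r x y \<longrightarrow> \<rho> y = \<rho> x + 1)"

definition finite_graded_poset :: "'a set \<Rightarrow> 'a rel \<Rightarrow> ('a \<Rightarrow> int) \<Rightarrow> bool" where
  "finite_graded_poset A r \<rho> \<longleftrightarrow>
     finite A \<and> partial_order_on A r \<and>
     (\<exists>x\<in>A. \<forall>z\<in>A. (x, z) \<in> r) \<and> (\<exists>y\<in>A. \<forall>z\<in>A. (z, y) \<in> r) \<and>
     rank_function r \<rho>"

definition eulerian_poset :: "'a set \<Rightarrow> 'a rel \<Rightarrow> ('a \<Rightarrow> int) \<Rightarrow> bool" where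
  "eulerian_poset A r \<rho> \<longleftrightarrow>
     finite_graded_poset A r \<rho> \<and>
     (\<forall>x y. (x, y) \<in> r \<and> \<rho> y - \<rho> x \<ge> 1 \<longrightarrow>
        (\<Sum>z\<in>poset_interval r x y. (- 1 :: real) powi \<rho> z) = 0)"


section \<open>Level posets\<close>

text \<open>
  The finite nonempty index set of the matrix is the type \<open>'v\<close>. The library's \<open>M ^ k\<close> on
  \<open>real ^ 'v ^ 'v\<close> is the entrywise power, so the power for the matrix product is defined here.
\<close>

primrec matrix_power :: "real ^ 'v ^ 'v \<Rightarrow> nat \<Rightarrow> real ^ 'v ^ 'v" where
  "matrix_power M 0 = mat 1"
| "matrix_power M (Suc k) = matrix_power M k ** M"

definition binary_matrix :: "real ^ 'v ^ 'v \<Rightarrow> bool" where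
  "binary_matrix M \<longleftrightarrow> (\<forall>u v. M $ u $ v \<in> {0, 1})"

definition indecomposable_matrix :: "real ^ 'v ^ 'v \<Rightarrow> bool" where
  "indecomposable_matrix M \<longleftrightarrow>
     (\<forall>i j. M $ i $ j \<ge> 0) \<and> (\<forall>i j. \<exists>t>0. matrix_power M t $ i $ j > 0)"

definition level_poset :: "real ^ 'v ^ 'v \<Rightarrow> ('v \<times> int) rel" where
  "level_poset M =
     {((u, i), (v, j)) |u i v j.
        (u, i) = (v, j) \<or> i < j \<and> matrix_power M (nat (j - i)) $ u $ v > 0}"

text \<open>Every interval, as a poset with the induced order and the rank function \<^const>\<open>snd\<close>, is Eulerian.\<close>

definition level_eulerian :: "('v \<times> int) rel \<Rightarrow> bool" where
  "level_eulerian P \<longleftrightarrow>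
     (\<forall>x y. (x, y) \<in> P \<longrightarrow>
        eulerian_poset (poset_interval P x y) (Restr P (poset_interval P x y)) snd)"


section \<open>Level posets of binary matrices have finite graded intervals\<close>

lemma matrix_power_add: "matrix_power M (a + b) = matrix_power M a ** matrix_power M b"
  by (induction b) (simp_all add: matrix_mul_assoc)

lemma matrix_power_nonneg:
  assumes "binary_matrix M"
  shows "matrix_power M k $ u $ v \<ge> 0"
proof (induction k arbitrary: v)
  case 0
  show ?case by (simp add: mat_def)
next
  case (Suc k)
  have "M $ w $ v \<ge> 0" for w
    using assms[unfolded binary_matrix_def, rule_format, of w v] by auto
  with Suc show ?case by (simp add: matrix_matrix_mult_def sum_nonneg)
qed

lemma matrix_power_add_pos_iff:
  assumes "binary_matrix M"
  shows "matrix_power M (a + b) $ u $ v > 0 \<longleftrightarrow>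
    (\<exists>w. matrix_power M a $ u $ w > 0 \<and> matrix_power M b $ w $ v > 0)"
proof -
  let ?f = "\<lambda>w. matrix_power M a $ u $ w * matrix_power M b $ w $ v"
  have nn: "?f w \<ge> 0" for w
    using matrix_power_nonneg[OF assms] by simp
  have "matrix_power M (a + b) $ u $ v = sum ?f UNIV"
    by (simp add: matrix_power_add matrix_matrix_mult_def)
  moreover have "sum ?f UNIV > 0 \<longleftrightarrow> (\<exists>w. ?f w > 0)"
    using sum_nonneg_eq_0_iff[of UNIV ?f] sum_nonneg[of UNIV ?f] nn
    by (force simp: less_le)
  moreover have "?f w > 0 \<longleftrightarrow> matrix_power M a $ u $ w > 0 \<and> matrix_power M b $ w $ v > 0" for w
    using matrix_power_nonneg[OF assms, of a u w] matrix_power_nonneg[OF assms, of b w v]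
    by (auto simp: zero_less_mult_iff)
  ultimately show ?thesis by simp
qed

lemma level_poset_iff:
  "((u, i), (v, j)) \<in> level_poset M \<longleftrightarrow>
     (u, i) = (v, j) \<or> i < j \<and> matrix_power M (nat (j - i)) $ u $ v > 0"
  by (auto simp: level_poset_def)

lemma level_poset_partial_order:
  assumes "binary_matrix M"
  shows "partial_order_on UNIV (level_poset M)"
proof -
  have "trans (level_poset M)"
  proof (rule transI)
    fix x y z assume xy: "(x, y) \<in> level_poset M" and yz: "(y, z) \<in> level_poset M"
    obtain u i v j w k where [simp]: "x = (u, i)" "y = (v, j)" "z = (w, k)"
      by (metis surj_pair)
    show "(x, z) \<in> level_poset M"
    proof (cases "x = y \<or> y = z")
      case False
      with xy yz have "i < j" "j < k" "matrix_power M (nat (j - i)) $ u $ v > 0"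
        "matrix_power M (nat (k - j)) $ v $ w > 0"
        by (auto simp: level_poset_iff)
      moreover from this have "nat (k - i) = nat (j - i) + nat (k - j)" by simp
      ultimately show ?thesis
        by (auto simp: level_poset_iff matrix_power_add_pos_iff[OF assms])
    qed (use xy yz in auto)
  qed
  then show ?thesis
    by (auto simp: partial_order_on_def preorder_on_def refl_on_def antisym_def level_poset_iff)
qed

lemma level_poset_rank_function:
  assumes "binary_matrix M"
  shows "rank_function (level_poset M) snd"
  unfolding rank_function_def
proof (intro conjI allI impI)
  fix x y assume "covered_by (level_poset M) x y"
  moreover obtain u i v j where [simp]: "x = (u, i)" "y = (v, j)" by (metis surj_pair)
  ultimately have ij: "i < j" and pos: "matrix_power M (nat (j - i)) $ u $ v > 0"
    and cov: "poset_interval (level_poset M) x y = {x, y}"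
    by (auto simp: covered_by_def level_poset_iff)
  show "snd y = snd x + 1"
  proof (rule ccontr)
    assume "snd y \<noteq> snd x + 1"
    with ij have ij': "i + 1 < j" by simp
    then have "nat (j - i) = 1 + nat (j - (i + 1))" by simp
    with pos obtain w where w: "matrix_power M 1 $ u $ w > 0"
      "matrix_power M (nat (j - (i + 1))) $ w $ v > 0"
      by (metis matrix_power_add_pos_iff[OF assms])
    with ij' have "(w, i + 1) \<in> poset_interval (level_poset M) x y"
      by (simp add: poset_interval_def level_poset_iff)
    with cov ij' show False by simp
  qed
qed (auto simp: level_poset_iff)

lemma level_poset_interval_graded:
  assumes M: "binary_matrix M" and xy: "(x, y) \<in> level_poset M"
  defines "A \<equiv> poset_interval (level_poset M) x y"
  shows "finite_graded_poset A (Restr (level_poset M) A) snd"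
proof -
  let ?P = "level_poset M"
  have po: "refl_on UNIV ?P" "trans ?P" "antisym ?P"
    using partial_order_onD[OF level_poset_partial_order[OF M]] by auto
  have "A \<subseteq> UNIV \<times> {snd x..snd y}"
    by (auto simp: A_def poset_interval_def level_poset_def)
  then have "finite A" by (rule finite_subset) simp
  moreover have "partial_order_on A (Restr ?P A)"
    using po by (auto simp: partial_order_on_def preorder_on_def refl_on_def
        intro: trans_Restr antisym_Restr)
  moreover have "x \<in> A" "y \<in> A"
    using refl_onD[OF po(1)] xy by (simp_all add: A_def poset_interval_def)
  then have "\<exists>a\<in>A. \<forall>z\<in>A. (a, z) \<in> Restr ?P A" "\<exists>b\<in>A. \<forall>z\<in>A. (z, b) \<in> Restr ?P A"
    by (intro bexI[of _ x] bexI[of _ y]; simp add: A_def poset_interval_def)+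
  moreover have "poset_interval (Restr ?P A) a b = poset_interval ?P a b"
    if "a \<in> A" "b \<in> A" for a b
    using that po(2) by (auto simp: A_def poset_interval_def dest: transD)
  then have "rank_function (Restr ?P A) snd"
    using level_poset_rank_function[OF M] unfolding rank_function_def covered_by_def
    by (metis IntD1 IntD2 mem_Sigma_iff)
  ultimately show ?thesis by (simp add: finite_graded_poset_def)
qed

end

theory Submission
  imports Defs
begin

text \<open>
  Write \<open>B\<^sub>k\<close> for the 0/1 matrix of the support of \<open>M\<^sup>k\<close>. Eulerianness of the intervals
  \<open>[(u, 0), (u, 2k)]\<close> shows that \<open>\<Sum>\<^sub>i (-1)\<^sup>i B\<^sub>i B\<^bsub>2k - i\<^esub>\<close> has zero diagonal. The trace of the
  summand is invariant under \<open>i \<mapsto> 2k - i\<close>, so the trace of the middle term \<open>B\<^sub>k\<^sup>2\<close> is even,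
  and modulo 2 it equals the trace of \<open>B\<^sub>k\<close>. By indecomposability some \<open>k\<close> is a common return
  time of all indices, and for this \<open>k\<close> the trace of \<open>B\<^sub>k\<close> is the order of \<open>M\<close>.
\<close>

text \<open>By symmetry the off-diagonal terms at \<open>(u, w)\<close> and \<open>(w, u)\<close>
  pair up to an even number.\<close>

lemma even_sum_symmetric_diff_diagonal:
  fixes f :: "'a \<Rightarrow> 'a \<Rightarrow> int"
  assumes "finite A" and sym: "\<And>u w. f u w = f w u"
  shows "even ((\<Sum>u\<in>A. \<Sum>w\<in>A. f u w) - (\<Sum>u\<in>A. f u u))"
  using assms(1)
proof induction
  case (insert a A)
  have "(\<Sum>u\<in>A. f u a) = (\<Sum>w\<in>A. f a w)"
    by (simp add: sym)
  with insert show ?case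
    by (simp add: sum.distrib)
qed simp

text \<open>The reflection of \<open>i\<close> to \<open>2 * k - i\<close> preserves the parity of
  \<open>i\<close>, hence the sign, and fixes only \<open>k\<close>; all other terms cancel in pairs
  modulo 2.\<close>

lemma even_middle_of_alternating_sum:
  fixes N :: "nat \<Rightarrow> int"
  assumes zero: "(\<Sum>i\<le>2 * k. (- 1) ^ i * N i) = 0"
    and sym: "\<And>i. i \<le> 2 * k \<Longrightarrow> N (2 * k - i) = N i"
  shows "even (N k)"
proof -
  let ?g = "\<lambda>i. (- 1) ^ i * N i"
  have refl: "?g (2 * k - i) = ?g i" if "i \<le> 2 * k" for i
    using sym[OF that] that by (simp add: minus_one_power_iff)
  have "sum ?g {k<..2 * k} = sum ?g {..<k}"
    by (rule sum.reindex_bij_witness[where i = "\<lambda>i. 2 * k - i" and j = "\<lambda>i. 2 * k - i"])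
      (auto simp: refl)
  moreover have "{..2 * k} = insert k ({..<k} \<union> {k<..2 * k})"
    by auto
  then have "sum ?g {..2 * k} = sum ?g {..<k} + ?g k + sum ?g {k<..2 * k}"
    using sum.union_disjoint[of "{..<k}" "{k<..2 * k}" ?g] by (simp add: disjoint_iff)
  ultimately have "?g k = - 2 * sum ?g {..<k}"
    using zero by simp
  then have "even (?g k)"
    by simp
  then show ?thesis
    by simp
qed

lemma matrix_power_diag_pos_mult:
  assumes M: "binary_matrix M" and pos: "matrix_power M t $ u $ u > 0"
  shows "matrix_power M (m * t) $ u $ u > 0"
proof (induction m)
  case 0
  show ?case by (simp add: mat_def)
next
  case (Suc m)
  with pos show ?case
    using matrix_power_add_pos_iff[OF M, of t "m * t"] by auto
qed

text \<open>Closed walks can be repeated, so the product of one return time per index serves all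
  indices.\<close>

lemma indecomposable_common_return_time:
  fixes M :: "real ^ 'v ^ 'v"
  assumes M: "binary_matrix M" and ind: "indecomposable_matrix M"
  obtains k where "k > 0" "\<And>u. matrix_power M k $ u $ u > 0"
proof -
  have "\<forall>u. \<exists>t>0. matrix_power M t $ u $ u > 0"
    using ind by (simp add: indecomposable_matrix_def)
  then obtain t where t: "\<And>u. t u > 0" "\<And>u. matrix_power M (t u) $ u $ u > 0"
    by metis
  show thesis
  proof
    show "prod t UNIV > 0"
      using t(1) by (simp add: prod_pos)
    fix u
    have "prod t UNIV = prod t (UNIV - {u}) * t u"
      by (simp add: prod.remove[of UNIV u] mult.commute)
    then show "matrix_power M (prod t UNIV) $ u $ u > 0"
      using matrix_power_diag_pos_mult[OF M t(2)] by simp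
  qed
qed

text \<open>The entries of \<open>B\<^sub>k\<close>, taken as integers so that parity makes
  sense.\<close>

definition walk_indicator :: "real ^ 'v ^ 'v \<Rightarrow> nat \<Rightarrow> 'v \<Rightarrow> 'v \<Rightarrow> int" where
  "walk_indicator M k u v = of_bool (matrix_power M k $ u $ v > 0)"

lemma level_poset_interval_eq:
  assumes "matrix_power M p $ u $ v > 0" "p > 0"
  shows "poset_interval (level_poset M) (u, 0) (v, int p) =
    (\<lambda>(i, w). (w, int i)) ` (SIGMA i:{..p}.
      {w. matrix_power M i $ u $ w > 0 \<and> matrix_power M (p - i) $ w $ v > 0})"
    (is "?I = ?J")
proof
  show "?I \<subseteq> ?J"
  proof
    fix z assume "z \<in> ?I"
    moreover obtain w j where z: "z = (w, j)" by (metis surj_pair)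
    ultimately have "0 \<le> j" "j \<le> int p"
      and pos: "matrix_power M (nat j) $ u $ w > 0" "matrix_power M (nat (int p - j)) $ w $ v > 0"
      using assms by (auto simp: poset_interval_def level_poset_iff mat_def)
    then have "(nat j, w) \<in> (SIGMA i:{..p}.
        {w. matrix_power M i $ u $ w > 0 \<and> matrix_power M (p - i) $ w $ v > 0})"
      by (auto simp: nat_diff_distrib')
    then show "z \<in> ?J"
      using z \<open>0 \<le> j\<close> by (force simp: image_iff)
  qed
  show "?J \<subseteq> ?I"
  proof
    fix z assume "z \<in> ?J"
    then obtain i w where z: "z = (w, int i)" "i \<le> p"
      and pos: "matrix_power M i $ u $ w > 0" "matrix_power M (p - i) $ w $ v > 0"
      by auto
    have "nat (int p - int i) = p - i" by simp
    \<comment> \<open>At the end levels the power 0 is the identity matrix, which forces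
      \<open>w = u\<close> or \<open>w = v\<close> and so matches the reflexive part of the
      order.\<close>
    with z pos show "z \<in> ?I"
      by (cases "i = 0"; cases "i = p")
        (auto simp: poset_interval_def level_poset_iff mat_def split: if_splits)
  qed
qed

text \<open>If no walk of length \<open>p\<close> leads from \<open>u\<close> to \<open>v\<close>,
  every term vanishes. Otherwise this is the Eulerian condition for the whole interval from
  \<open>(u, 0)\<close> to \<open>(v, p)\<close>, counted level by level.\<close>

lemma level_eulerian_alternating_sum:
  fixes M :: "real ^ 'v ^ 'v"
  assumes M: "binary_matrix M" and eul: "level_eulerian (level_poset M)" and p: "p > 0"
  shows "(\<Sum>i\<le>p. (- 1) ^ i * (\<Sum>w\<in>UNIV. walk_indicator M i u w * walk_indicator M (p - i) w v)) = 0"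
proof (cases "matrix_power M p $ u $ v > 0")
  case False
  have "\<not> (matrix_power M i $ u $ w > 0 \<and> matrix_power M (p - i) $ w $ v > 0)"
    if "i \<le> p" for i w
    using matrix_power_add_pos_iff[OF M, of i "p - i" u v] that False by auto
  then have "walk_indicator M i u w * walk_indicator M (p - i) w v = 0" if "i \<le> p" for i w
    using that by (auto simp: walk_indicator_def)
  then show ?thesis
    by (simp del: mult_eq_0_iff)
next
  case True
  let ?P = "level_poset M" and ?x = "(u, 0)" and ?y = "(v, int p)"
  let ?A = "poset_interval ?P ?x ?y"
  let ?S = "\<lambda>i. {w. matrix_power M i $ u $ w > 0 \<and> matrix_power M (p - i) $ w $ v > 0}"
  have xy: "(?x, ?y) \<in> ?P"
    using True p by (simp add: level_poset_iff)
  then have "?x \<in> ?A" "?y \<in> ?A"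
    by (auto simp: poset_interval_def level_poset_iff)
  then have "(?x, ?y) \<in> Restr ?P ?A" "poset_interval (Restr ?P ?A) ?x ?y = ?A"
    using xy by (auto simp: poset_interval_def)
  moreover have "eulerian_poset ?A (Restr ?P ?A) snd"
    using eul xy by (simp add: level_eulerian_def)
  ultimately have "0 = (\<Sum>z\<in>?A. (- 1 :: real) powi snd z)"
    using p unfolding eulerian_poset_def by force
  also have "\<dots> = (\<Sum>(i, w)\<in>Sigma {..p} ?S. (- 1) ^ i)"
    unfolding level_poset_interval_eq[OF True p]
    by (subst sum.reindex) (auto simp: inj_on_def intro!: sum.cong)
  also have "\<dots> = (\<Sum>i\<le>p. \<Sum>w\<in>?S i. (- 1) ^ i)"
    by (rule sum.Sigma[symmetric]) simp_all
  also have "\<dots> = (\<Sum>i\<le>p. (- 1) ^ i * real (card (?S i)))"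
    by (simp add: mult.commute)
  also have "\<dots> = of_int (\<Sum>i\<le>p. (- 1) ^ i * int (card (?S i)))"
    by simp
  finally have "(\<Sum>i\<le>p. (- 1) ^ i * int (card (?S i))) = 0"
    by linarith
  moreover have "int (card (?S i)) = (\<Sum>w\<in>UNIV. walk_indicator M i u w * walk_indicator M (p - i) w v)" for i
    by (simp add: walk_indicator_def sum_of_bool_eq flip: of_bool_conj)
  ultimately show ?thesis
    by simp
qed

theorem theorem4p9:
  fixes M :: "real ^ 'v ^ 'v"
  assumes "binary_matrix M"
    and "level_eulerian (level_poset M)"
    and "indecomposable_matrix M"
  shows "even CARD('v)"
proof -
  obtain k where k: "k > 0" "\<And>u. matrix_power M k $ u $ u > 0"
    using indecomposable_common_return_time assms(1,3) by blast
  define N where "N i = (\<Sum>u\<in>UNIV. \<Sum>w\<in>UNIV. walk_indicator M i u w * walk_indicator M (2 * k - i) w u)" for i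
  have "(\<Sum>i\<le>2 * k. (- 1) ^ i * N i) = (\<Sum>u\<in>UNIV. \<Sum>i\<le>2 * k.
      (- 1) ^ i * (\<Sum>w\<in>UNIV. walk_indicator M i u w * walk_indicator M (2 * k - i) w u))"
    unfolding N_def by (subst sum.swap) (simp add: sum_distrib_left)
  also have "\<dots> = 0"
    using level_eulerian_alternating_sum[OF assms(1,2)] k(1) by simp
  finally have "(\<Sum>i\<le>2 * k. (- 1) ^ i * N i) = 0" .
  \<comment> \<open>Cyclicity of the trace.\<close>
  moreover have "N (2 * k - i) = N i" if "i \<le> 2 * k" for i
    unfolding N_def using that by (subst sum.swap) (simp add: mult.commute)
  ultimately have "even (N k)"
    by (rule even_middle_of_alternating_sum)
  moreover have "even (N k - (\<Sum>u\<in>UNIV. walk_indicator M k u u * walk_indicator M k u u))"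
    unfolding N_def
    using even_sum_symmetric_diff_diagonal[of UNIV "\<lambda>u w. walk_indicator M k u w * walk_indicator M k w u"]
    by (simp add: mult.commute)
  \<comment> \<open>By the choice of \<open>k\<close> every diagonal indicator is 1, so the diagonal
    sum counts the indices.\<close>
  ultimately show ?thesis
    using k(2) by (simp add: walk_indicator_def)
qed

end
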